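(* Let $n$ be a positive integer and $b>1$ an integer. Then $2^n$ has a 3-digit palindromic representation in base $b$ (that is, $2^n=c+db+cb^2$ for integers $1\le c\le b-1$, $0\le d\le b-1$) if and only if $b^2+1\le 2^n\le b^3-1$, the integer $c:=2^n \bmod b$ is nonzero, and \[\frac{1}{b}\left\lfloor\frac{2^n}{b}\right\rfloor-\frac{b-1}{b}\;\le\; c\;\le\;\frac{1}{b}\left\lfloor\frac{2^n}{b}\right\rfloor.\]
   Context: For an integer $b>1$, every positive integer $N$ can be written uniquely as $N=\sum_{i=0}^m c_i b^i$ with integers $0\le c_i<b$ and $c_m>0$; this is written $N=(c_m,\ldots,c_0)_b$ and has $m+1$ digits. It is palindromic if $c_j=c_{m-j}$ for all $j$. Here $2^n \bmod b$ denotes the least nonnegative residue of $2^n$ modulo $b$. *)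

theory Defs
  imports Complex_Main
begin

text \<open>Digit lists are little-endian: the entry at index \<open>i\<close> is the coefficient \<open>c\<^sub>i\<close> of \<open>b ^ i\<close>,
  so that \<open>[c\<^sub>0, ..., c\<^sub>m]\<close> encodes \<open>(c\<^sub>m, ..., c\<^sub>0)\<^sub>b\<close> and the number of digits is the length.\<close>

definition base_repr :: "int \<Rightarrow> int list \<Rightarrow> int \<Rightarrow> bool" where
  "base_repr b cs N \<longleftrightarrow>
     cs \<noteq> [] \<and> (\<forall>i<length cs. 0 \<le> cs ! i \<and> cs ! i < b) \<and> last cs > 0 \<and>
     N = (\<Sum>i<length cs. cs ! i * b ^ i)"

definition palindromic_digits :: "int list \<Rightarrow> bool" where
  "palindromic_digits cs \<longleftrightarrow> (\<forall>j<length cs. cs ! j = cs ! (length cs - 1 - j))"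

definition has_palindromic_repr :: "nat \<Rightarrow> int \<Rightarrow> int \<Rightarrow> bool" where
  "has_palindromic_repr k b N \<longleftrightarrow>
     (\<exists>cs. length cs = k \<and> base_repr b cs N \<and> palindromic_digits cs)"

lemma has_palindromic_repr_3_iff:
  "has_palindromic_repr 3 b N \<longleftrightarrow>
     (\<exists>c d. 1 \<le> c \<and> c \<le> b - 1 \<and> 0 \<le> d \<and> d \<le> b - 1 \<and> N = c + d * b + c * b\<^sup>2)"
proof
  assume "has_palindromic_repr 3 b N"
  then obtain cs where cs: "length cs = 3" "base_repr b cs N" "palindromic_digits cs"
    unfolding has_palindromic_repr_def by blast
  from cs(1) obtain x y z where "cs = [x, y, z]"
    by (auto simp: numeral_3_eq_3 length_Suc_conv)
  with cs(2,3) have "1 \<le> x \<and> x \<le> b - 1 \<and> 0 \<le> y \<and> y \<le> b - 1 \<and> N = x + y * b + x * b\<^sup>2"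
    by (auto simp: base_repr_def palindromic_digits_def less_Suc_eq_0_disj
          lessThan_Suc power2_eq_square)
  then show "\<exists>c d. 1 \<le> c \<and> c \<le> b - 1 \<and> 0 \<le> d \<and> d \<le> b - 1 \<and> N = c + d * b + c * b\<^sup>2"
    by blast
next
  assume "\<exists>c d. 1 \<le> c \<and> c \<le> b - 1 \<and> 0 \<le> d \<and> d \<le> b - 1 \<and> N = c + d * b + c * b\<^sup>2"
  then obtain c d where "1 \<le> c" "c \<le> b - 1" "0 \<le> d" "d \<le> b - 1" "N = c + d * b + c * b\<^sup>2"
    by blast
  then have "base_repr b [c, d, c] N" "palindromic_digits [c, d, c]"
    by (auto simp: base_repr_def palindromic_digits_def less_Suc_eq_0_disj
          lessThan_Suc power2_eq_square)
  then show "has_palindromic_repr 3 b N"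
    unfolding has_palindromic_repr_def by (intro exI[of _ "[c, d, c]"]) simp
qed

end

theory Submission
  imports Defs
begin

text \<open>The value grows with each digit, so the extremes occur at \<open>c = 1\<close>,
  \<open>d = 0\<close> and at \<open>c = d = b - 1\<close>.\<close>

lemma palindromic_repr_3_bounds:
  fixes b c d :: int
  assumes "1 \<le> c" "c \<le> b - 1" "0 \<le> d" "d \<le> b - 1"
  shows "b\<^sup>2 + 1 \<le> c + d * b + c * b\<^sup>2" "c + d * b + c * b\<^sup>2 \<le> b ^ 3 - 1"
proof -
  have b: "b \<ge> 0" using assms by linarith
  have "1 * b\<^sup>2 \<le> c * b\<^sup>2" by (rule mult_right_mono) (use assms in auto)
  moreover have "0 \<le> d * b" using assms b by simp
  ultimately show "b\<^sup>2 + 1 \<le> c + d * b + c * b\<^sup>2" using assms by linarith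
  have "d * b \<le> (b - 1) * b" "c * b\<^sup>2 \<le> (b - 1) * b\<^sup>2"
    using assms b by (auto intro: mult_right_mono)
  then have "c + d * b + c * b\<^sup>2 \<le> (b - 1) + (b - 1) * b + (b - 1) * b\<^sup>2"
    using assms by linarith
  \<comment> \<open>With all three digits equal to \<open>b - 1\<close> the sum telescopes, being
    \<open>(b - 1) * (1 + b + b\<^sup>2)\<close>.\<close>
  also have "\<dots> = b ^ 3 - 1"
    by (simp add: algebra_simps power2_eq_square power3_eq_cube)
  finally show "c + d * b + c * b\<^sup>2 \<le> b ^ 3 - 1" .
qed

text \<open>The middle digit is forced to be \<open>N div b - c * b\<close>, where \<open>c = N mod b\<close>; the last two
  inequalities say that it lies between \<open>0\<close> and \<open>b - 1\<close>.\<close>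

lemma has_palindromic_repr_3_iff_div_mod:
  fixes b N :: int
  assumes "b > 1"
  shows "has_palindromic_repr 3 b N \<longleftrightarrow>
    b\<^sup>2 + 1 \<le> N \<and> N \<le> b ^ 3 - 1 \<and>
    N mod b \<noteq> 0 \<and> N div b - (b - 1) \<le> b * (N mod b) \<and> b * (N mod b) \<le> N div b"
proof
  assume "has_palindromic_repr 3 b N"
  then obtain c d where cd: "1 \<le> c" "c \<le> b - 1" "0 \<le> d" "d \<le> b - 1"
    and N: "N = c + d * b + c * b\<^sup>2"
    unfolding has_palindromic_repr_3_iff by blast
  \<comment> \<open>In Horner form, remainder and quotient by \<open>b\<close> can be read off,
    because \<open>0 \<le> c < b\<close>.\<close>
  have N': "N = c + b * (d + b * c)"
    unfolding N by (simp add: algebra_simps power2_eq_square)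
  have "N mod b = c" "N div b = d + b * c"
    unfolding N' using cd by simp_all
  with cd palindromic_repr_3_bounds[OF cd] show "b\<^sup>2 + 1 \<le> N \<and> N \<le> b ^ 3 - 1 \<and>
    N mod b \<noteq> 0 \<and> N div b - (b - 1) \<le> b * (N mod b) \<and> b * (N mod b) \<le> N div b"
    by (simp add: N)
next
  define c where "c = N mod b"
  define d where "d = N div b - b * c"
  assume "b\<^sup>2 + 1 \<le> N \<and> N \<le> b ^ 3 - 1 \<and>
    N mod b \<noteq> 0 \<and> N div b - (b - 1) \<le> b * (N mod b) \<and> b * (N mod b) \<le> N div b"
  then have "c \<noteq> 0" "0 \<le> d" "d \<le> b - 1"
    by (auto simp: c_def d_def)
  \<comment> \<open>Together with \<open>c \<noteq> 0\<close>, the range of a remainder makes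
    \<open>c\<close> an admissible leading digit.\<close>
  moreover have "0 \<le> c" "c < b"
    using assms by (simp_all add: c_def)
  moreover have "N = c + d * b + c * b\<^sup>2"
  proof -
    have "N = c + b * (N div b)" by (simp add: c_def)
    then show ?thesis by (simp add: d_def algebra_simps power2_eq_square)
  qed
  ultimately show "has_palindromic_repr 3 b N"
    unfolding has_palindromic_repr_3_iff by (intro exI[of _ c] exI[of _ d]) simp
qed

text \<open>This is the integer criterion for \<open>N = 2 ^ n\<close>, with its two inequalities
  divided by \<open>b\<close> and read over the reals.\<close>

theorem theorem2p1:
  fixes n :: nat and b :: int
  assumes "n > 0" and "b > 1"
  shows "has_palindromic_repr 3 b (2 ^ n) \<longleftrightarrow>
    b\<^sup>2 + 1 \<le> 2 ^ n \<and> 2 ^ n \<le> b ^ 3 - 1 \<and>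
    (let c = (2 ^ n mod b :: int) in
       c \<noteq> 0 \<and>
       1 / real_of_int b * real_of_int \<lfloor>2 ^ n / real_of_int b\<rfloor> - (real_of_int b - 1) / real_of_int b
         \<le> real_of_int c \<and>
       real_of_int c \<le> 1 / real_of_int b * real_of_int \<lfloor>2 ^ n / real_of_int b\<rfloor>)"
proof -
  define q c :: int where "q = 2 ^ n div b" and "c = 2 ^ n mod b"
  \<comment> \<open>The floor of a real quotient of two integers is their integer quotient.\<close>
  have q: "\<lfloor>2 ^ n / real_of_int b\<rfloor> = q"
    using floor_divide_of_int_eq[of "2 ^ n" b, where 'a = real] by (simp add: q_def)
  have b: "real_of_int b > 0" using assms by simp
  \<comment> \<open>Multiplying by \<open>b > 0\<close> clears the denominators. Each side is then a
    single cast of an integer, so \<open>of_int_le_iff\<close> can return to the integers.\<close>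
  have "1 / real_of_int b * real_of_int q - (real_of_int b - 1) / real_of_int b \<le> real_of_int c
      \<longleftrightarrow> real_of_int (q - (b - 1)) \<le> real_of_int (b * c)"
    using b by (simp add: field_simps)
  moreover have "real_of_int c \<le> 1 / real_of_int b * real_of_int q
      \<longleftrightarrow> real_of_int (b * c) \<le> real_of_int q"
    using b by (simp add: field_simps)
  ultimately show ?thesis
    unfolding has_palindromic_repr_3_iff_div_mod[OF \<open>b > 1\<close>] Let_def q
      c_def[symmetric] q_def[symmetric] of_int_le_iff by simp
qed

end
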